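(* Let $\delta>\frac{\pi^2}{4}-1$ and $\sigma_w^2=0$. For every $\alpha_0\in\mathbb{R}\setminus\{0\}$ and every $\sigma_0^2\in[0,\infty)$, the real SE sequences satisfy $$\lim_{t\to\infty}|\alpha_t|=1\qquad\text{and}\qquad\lim_{t\to\infty}\sigma_t^2=0.$$
   Context: Real state evolution. Fix $\delta>0$, $\sigma_w^2\ge0$. For $\alpha\in\mathbb{R}$, $\sigma^2\ge0$, $(\alpha,\sigma^2)\ne(0,0)$, with $\sigma=\sqrt{\sigma^2}$ and the convention $\arctan(\alpha/0)=\frac\pi2\,\mathrm{sign}(\alpha)$, define $$\psi_1(\alpha,\sigma^2)=\frac2\pi\arctan\Big(\frac\alpha\sigma\Big),\qquad \psi_2(\alpha,\sigma^2;\delta,\sigma_w^2)=\frac1\delta\Big[\alpha^2+\sigma^2+1-\frac{4\sigma}{\pi}-\frac{4\alpha}{\pi}\arctan\Big(\frac\alpha\sigma\Big)\Big]+\sigma_w^2 .$$ The real SE sequences are $\alpha_{t+1}=\psi_1(\alpha_t,\sigma_t^2)$, $\sigma_{t+1}^2=\psi_2(\alpha_t,\sigma_t^2;\delta,\sigma_w^2)$, $t\ge0$. *)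

theory Defs
  imports Complex_Main
begin

definition atq :: "real \<Rightarrow> real \<Rightarrow> real" where
  "atq a s = (if s = 0 then pi / 2 * sgn a else arctan (a / s))"

definition psi1 :: "real \<Rightarrow> real \<Rightarrow> real" where
  "psi1 a s2 = 2 / pi * atq a (sqrt s2)"

definition psi2 :: "real \<Rightarrow> real \<Rightarrow> real \<Rightarrow> real \<Rightarrow> real" where
  "psi2 a s2 \<delta> sw2 =
     1 / \<delta> * (a^2 + s2 + 1 - 4 * sqrt s2 / pi - 4 * a / pi * atq a (sqrt s2)) + sw2"

text \<open>Real state evolution: SE a0 s0 delta sw2 t = (alpha_t, sigma_t^2).\<close>
fun SE :: "real \<Rightarrow> real \<Rightarrow> real \<Rightarrow> real \<Rightarrow> nat \<Rightarrow> real \<times> real" where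
  "SE a0 s0 \<delta> sw2 0 = (a0, s0)"
| "SE a0 s0 \<delta> sw2 (Suc t) =
     (let (a, s2) = SE a0 s0 \<delta> sw2 t in (psi1 a s2, psi2 a s2 \<delta> sw2))"

end

theory Submission
  imports Defs "HOL-Analysis.Analysis"
begin

text \<open>
  By symmetry let \<open>\<alpha>\<^sub>0 > 0\<close>, and let \<open>\<phi>\<^sub>t \<in> (0, \<pi>/2]\<close> be the angle with
  \<open>\<sigma>\<^sub>t = \<alpha>\<^sub>t cot \<phi>\<^sub>t\<close>. Then \<open>\<alpha>\<^sub>t\<^sub>+\<^sub>1 = 2\<phi>\<^sub>t/\<pi>\<close>, so that the state evolution becomes a second-order
  recursion for the angles, and the claim is \<open>\<phi>\<^sub>t \<rightarrow> \<pi>/2\<close>. The condition on \<open>\<delta>\<close> enters through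
  one trigonometric inequality, which excludes fixed points with angle in \<open>(0, \<pi>/2)\<close>.

  The angles need not become monotone at once, but (i) they cannot decrease forever, since otherwise they
  would tend to a fixed point or to \<open>0\<close>, and near \<open>0\<close> the value \<open>\<sigma>\<^sub>t\<^sup>2\<close> would drop by a fixed amount
  in each step; (ii) a step after an increase \<open>p \<le> q\<close> does not fall below \<open>p\<close>; (iii) after an
  increase there are never two decreases in a row. By (ii) and (iii), \<open>min \<phi>\<^sub>t \<phi>\<^sub>t\<^sub>+\<^sub>1\<close> is
  eventually nondecreasing, and a compactness argument with the strict form of (ii) shows that its limit
  is \<open>\<pi>/2\<close>.
\<close>

subsection \<open>Taylor bounds and the critical inequality\<close>

text \<open>Integrating each bound from 0 yields the next one, alternating between sin and cos; the
  chain starts from \<open>sin x \<le> x\<close>.\<close>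

lemma nonneg_of_deriv_nonneg:
  fixes f f' :: "real \<Rightarrow> real"
  assumes "\<And>t. (f has_real_derivative f' t) (at t)"
    and "\<And>t. 0 \<le> t \<Longrightarrow> 0 \<le> f' t" and "f 0 = 0" and "0 \<le> x"
  shows "0 \<le> f x"
  using DERIV_nonneg_imp_nondecreasing[of 0 x f] assms by force

lemma cos_ge_Taylor2: "1 - x^2/2 \<le> cos x" if "0 \<le> x" for x :: real
  using nonneg_of_deriv_nonneg[of "\<lambda>x. cos x - (1 - x^2/2)" "\<lambda>x. x - sin x" x] that sin_x_le_x
  by (force intro!: derivative_eq_intros)

lemma sin_ge_Taylor3: "x - x^3/6 \<le> sin x" if "0 \<le> x" for x :: real
  using nonneg_of_deriv_nonneg[of "\<lambda>x. sin x - (x - x^3/6)" "\<lambda>x. cos x - (1 - x^2/2)" x] that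
    cos_ge_Taylor2
  by (force intro!: derivative_eq_intros)

lemma cos_le_Taylor4: "cos x \<le> 1 - x^2/2 + x^4/24" if "0 \<le> x" for x :: real
  using nonneg_of_deriv_nonneg[of "\<lambda>x. 1 - x^2/2 + x^4/24 - cos x" "\<lambda>x. sin x - (x - x^3/6)" x]
    that sin_ge_Taylor3
  by (force intro!: derivative_eq_intros simp: field_simps)

lemma sin_le_Taylor5: "sin x \<le> x - x^3/6 + x^5/120" if "0 \<le> x" for x :: real
  using nonneg_of_deriv_nonneg[of "\<lambda>x. x - x^3/6 + x^5/120 - sin x"
      "\<lambda>x. 1 - x^2/2 + x^4/24 - cos x" x] that cos_le_Taylor4
  by (force intro!: derivative_eq_intros simp: field_simps)

lemma cos_ge_Taylor6: "1 - x^2/2 + x^4/24 - x^6/720 \<le> cos x" if "0 \<le> x" for x :: real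
  using nonneg_of_deriv_nonneg[of "\<lambda>x. cos x - (1 - x^2/2 + x^4/24 - x^6/720)"
      "\<lambda>x. x - x^3/6 + x^5/120 - sin x" x] that sin_le_Taylor5
  by (force intro!: derivative_eq_intros simp: field_simps)

lemma sin_ge_Taylor7: "x - x^3/6 + x^5/120 - x^7/5040 \<le> sin x" if "0 \<le> x" for x :: real
  using nonneg_of_deriv_nonneg[of "\<lambda>x. sin x - (x - x^3/6 + x^5/120 - x^7/5040)"
      "\<lambda>x. cos x - (1 - x^2/2 + x^4/24 - x^6/720)" x] that cos_ge_Taylor6
  by (force intro!: derivative_eq_intros simp: field_simps)

lemma cos_le_Taylor8: "cos x \<le> 1 - x^2/2 + x^4/24 - x^6/720 + x^8/40320" if "0 \<le> x" for x :: real
  using nonneg_of_deriv_nonneg[of "\<lambda>x. 1 - x^2/2 + x^4/24 - x^6/720 + x^8/40320 - cos x"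
      "\<lambda>x. sin x - (x - x^3/6 + x^5/120 - x^7/5040)" x] that sin_ge_Taylor7
  by (force intro!: derivative_eq_intros simp: field_simps)

text \<open>The derivative of \<open>sin x - x * cos x\<close> is \<open>x * sin x\<close>, so the
  cubic bound for sin is multiplied by \<open>x\<close> and integrated.\<close>

lemma sin_minus_mult_cos_ge_Taylor:
  "x^3/3 - x^5/30 \<le> sin x - x * cos x" if "0 \<le> x" for x :: real
proof -
  have "0 \<le> t * sin t - (t^2 - t^4/6)" if "0 \<le> t" for t :: real
    using mult_left_mono[OF sin_ge_Taylor3[OF that] that]
    by (simp add: algebra_simps power2_eq_square power4_eq_xxxx power3_eq_cube)
  moreover have "((\<lambda>x. sin x - x * cos x - (x^3/3 - x^5/30)) has_real_derivative
      t * sin t - (t^2 - t^4/6)) (at t)" for t :: real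
    by (auto intro!: derivative_eq_intros)
  ultimately show ?thesis
    using nonneg_of_deriv_nonneg[of "\<lambda>x. sin x - x * cos x - (x^3/3 - x^5/30)"
        "\<lambda>x. x * sin x - (x^2 - x^4/6)" x] that by auto
qed

lemma pi_squared_bounds: "(98696/10000) < pi\<^sup>2" "pi\<^sup>2 < (98697/10000)"
proof -
  have "(314159265/100000000)\<^sup>2 \<le> pi\<^sup>2" "pi\<^sup>2 \<le> (3141593/1000000)\<^sup>2"
    using pi_approx by (intro power_mono; simp)+
  then show "(98696/10000) < pi\<^sup>2" "pi\<^sup>2 < (98697/10000)" by (simp_all add: power2_eq_square)
qed

section \<open>The critical inequality near both ends\<close>

text \<open>Rearranged, the inequality is \<open>A - B < (A + B) * c + 4 * s\<close>, which is
  monotone in \<open>c\<close> and \<open>s\<close>; so sin and cos may be replaced by Taylor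
  polynomials.\<close>

lemma critical_trig_mono:
  fixes A B C S c s :: real
  assumes "A * (1 - C) < B * (1 + C) + 4 * S" and "0 \<le> A + B" and "C \<le> c" and "S \<le> s"
  shows "A * (1 - c) < B * (1 + c) + 4 * s"
  using mult_left_mono[OF assms(3,2)] assms(1,4) by (simp add: algebra_simps)

text \<open>
  With \<open>y = 2p\<close> the critical inequality is tight to fourth order at \<open>y = 0\<close> and to second order
  at \<open>y = \<pi>\<close>, which forces separate Taylor expansions at the two ends.
\<close>

lemma critical_trig_small:
  fixes y :: real
  assumes "0 < y" "y \<le> 17/10"
  shows "(pi\<^sup>2 - y\<^sup>2) * (1 - cos y) < (pi\<^sup>2/4 - 2) * y\<^sup>2 * (1 + cos y) + 4 * y * sin y"
proof -
  define W where "W = pi\<^sup>2"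
  have W: "(98696/10000) < W" "W < (98697/10000)" using pi_squared_bounds by (auto simp: W_def)
  define z where "z = y\<^sup>2"
  have z: "0 < z" "z \<le> (289/100)" using assms power_mono[of y "17/10" 2] by (auto simp: z_def power2_eq_square)
  define C where "C = 1 - z/2 + z^2/24 - z^3/720"
  define S where "S = z - z^2/6 + z^3/120 - z^4/5040"
  have C: "C \<le> cos y" using cos_ge_Taylor6[of y] assms
    by (simp add: C_def z_def flip: power_mult)
  have S: "S \<le> y * sin y" using mult_left_mono[OF sin_ge_Taylor7[of y], of y] assms
    by (simp add: S_def z_def power_numeral_reduce algebra_simps)
  have AB: "0 \<le> (W - z) + (W/4 - 2) * z" using W z
    by (intro add_nonneg_nonneg mult_nonneg_nonneg) auto
  \<comment> \<open>The terms of order \<open>z\<close> cancel, so \<open>z^2\<close> factors out.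
    The constant term \<open>5/6 - W/12\<close> of the other factor outweighs the rest of
    it.\<close>
  have eq: "(W/4 - 2) * z * (1 + C) + 4 * S - (W - z) * (1 - C)
      = z^2 * ((5/6 - W/12) + (13/1440 * W - 11/120) * z + (17/5040 - W/2880) * z^2)"
    unfolding C_def S_def by (simp add: field_simps power_numeral_reduce)
  have pos: "0 < (5/6 - W/12) + (13/1440 * W - 11/120) * z + (17/5040 - W/2880) * z^2"
  proof -
    have "(13/1440 * W - 11/120) * z \<ge> - (2567/1000000) * z" using W z by (intro mult_right_mono) auto
    moreover have "(17/5040 - W/2880) * z^2 \<ge> -(54/1000000) * z^2"
      using W z by (intro mult_right_mono) auto
    moreover have "z^2 \<le> (289/100)^2" using z by (intro power_mono) auto
    ultimately show ?thesis using z W by (simp add: power2_eq_square)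
  qed
  have "0 < (W/4 - 2) * z * (1 + C) + 4 * S - (W - z) * (1 - C)"
    unfolding eq by (rule mult_pos_pos) (use z pos in simp_all)
  then have "(W - z) * (1 - C) < (W/4 - 2) * z * (1 + C) + 4 * S"
    by (rule diff_gt_0_iff_gt[THEN iffD1])
  from critical_trig_mono[OF this AB C S]
  have "(W - z) * (1 - cos y) < (W/4 - 2) * z * (1 + cos y) + 4 * (y * sin y)" .
  then show ?thesis by (simp add: z_def W_def mult.assoc)
qed

text \<open>The Taylor minorant at \<open>y = \<pi> - e\<close> starts with \<open>e\<^sup>2\<close>; this is its quotient by \<open>e\<^sup>2\<close> for \<open>P = \<pi>\<close>.\<close>

definition critical_remainder :: "real \<Rightarrow> real \<Rightarrow> real" where
  "critical_remainder P e =
    (P^4/8 - P^2 - 2) + P * (7/3 - P^2/4) * e + (5/24 * P^2 - 5/6 - P^4/96) * e^2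
       + P * (P^2/48 - 13/60) * e^3 + (11/120 - 19/1440*P^2 + P^4/2880) * e^4
       + P * (19/2520 - P^2/1440) * e^5 + (P^2/2520 - 17/5040 - P^4/161280) * e^6
       + P * (P^2/80640 - 1/6720) * e^7 + (1/13440 - P^2/161280) * e^8"

lemma critical_remainder_identity:
  fixes P e :: real
  defines "C \<equiv> 1 - e^2/2 + e^4/24 - e^6/720 + e^8/40320"
    and "S \<equiv> e - e^3/6 + e^5/120 - e^7/5040"
  shows "(P^2/4-2) * (P-e)^2 * (1-C) + 4*(P-e)*S - (P^2 - (P-e)^2)*(1+C)
    = e^2 * critical_remainder P e"
proof -
  have "40320 * C = 40320 - 20160*e^2 + 1680*e^4 - 56*e^6 + e^8" by (simp add: C_def)
  moreover have "5040 * S = 5040*e - 840*e^3 + 42*e^5 - e^7" by (simp add: S_def)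
  \<comment> \<open>161280 is 4 * 8!, which clears all denominators and leaves an identity between
    integer polynomials.\<close>
  ultimately have "161280 * ((P^2/4-2) * (P-e)^2 * (1-C) + 4*(P-e)*S - (P^2 - (P-e)^2)*(1+C))
     = (P^2-8) * (P-e)^2 * (20160*e^2 - 1680*e^4 + 56*e^6 - e^8) 
       + 128 * (P-e) * (5040*e - 840*e^3 + 42*e^5 - e^7)
       - 4*(P^2 - (P-e)^2) * (80640 - 20160*e^2 + 1680*e^4 - 56*e^6 + e^8)"
    unfolding left_diff_distrib right_diff_distrib distrib_left distrib_right
    by simp algebra
  also have "\<dots> = e^2 * ((20160*P^4 - 161280*P^2 - 322560) + P * (376320 - 40320*P^2) * e + (33600 * P^2 - 134400 - 1680*P^4) * e^2
       + P * (3360*P^2 - 34944) * e^3 + (14784 - 2128*P^2 + 56*P^4) * e^4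
       + P * (1216 - 112*P^2) * e^5 + (64*P^2 - 544 - P^4) * e^6
       + P * (2*P^2 - 24) * e^7 + (12 - P^2) * e^8)" by algebra
  finally show ?thesis by (simp add: critical_remainder_def field_simps)
qed

text \<open>The coefficients are replaced by numerical lower bounds, and powers of \<open>e\<close>
  above the third are absorbed, which leaves a cubic.\<close>

lemma critical_remainder_pos:
  assumes "0 < e" "e \<le> 145/100"
  shows "0 < critical_remainder pi e"
proof -
  define P where "P = pi"
  have P: "314159/100000 < P" "P < 31416/10000" using pi_approx by (auto simp: P_def)
  have P2: "98696/10000 < P^2" "P^2 < 98697/10000" using pi_squared_bounds by (auto simp: P_def)
  have P4: "(9740900/100000) < P^4" "P^4 < (9741098/100000)"
  proof -
    have "(98696/10000)^2 < (P^2)^2" "(P^2)^2 < (98697/10000)^2"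
      using P2 by (intro power_strict_mono; simp)+
    moreover have "(P^2)^2 = P^4" by (simp flip: power_mult)
    ultimately show "(9740900/100000) < P^4" "P^4 < (9741098/100000)" by (simp_all add: power2_eq_square)
  qed
  have c2: "P^4/8 - P^2 - 2 \<ge> (3062/10000)" using P2 P4 by linarith
  have c3: "P * (7/3 - P^2/4) \<ge> - (4213/10000)"
    using mult_mono[of P "31416/10000" "P^2/4 - 7/3" "(134092/1000000)"] P P2 by (simp add: algebra_simps)
  have c4: "5/24 * P^2 - 5/6 - P^4/96 \<ge> (208/1000)" using P2 P4 by linarith
  have c5: "P * (P^2/48 - 13/60) \<ge> - (348/10000)"
    using mult_mono[of P "31416/10000" "13/60 - P^2/48" "(1106/100000)"] P P2 by (simp add: algebra_simps)
  have c6: "11/120 - 19/1440*P^2 + P^4/2880 \<ge> -(48/10000)" using P2 P4 by linarith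
  have c7: "P * (19/2520 - P^2/1440) \<ge> (2/1000)"
    using mult_mono[of "314/100" P "(68/100000)" "19/2520 - P^2/1440"] P P2 by (simp add: algebra_simps)
  have c8: "P^2/2520 - 17/5040 - P^4/161280 \<ge> -(2/10000)" using P2 P4 by linarith
  have c9: "P * (P^2/80640 - 1/6720) \<ge> -(1/10000)"
    using mult_mono[of P "31416/10000" "1/6720 - P^2/80640" "(3/100000)"] P P2 by (simp add: algebra_simps)
  have c10: "1/13440 - P^2/161280 \<ge> 0" using P2 by linarith
  let ?p = "(3062/10000) + (-(4213/10000)) * e + (208/1000) * e^2 + (-(348/10000)) * e^3 + (-(48/10000)) * e^4
     + (2/1000) * e^5 + (-(2/10000)) * e^6 + (-(1/10000)) * e^7 + 0 * e^8"
  have "?p \<le> critical_remainder P e"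
    unfolding critical_remainder_def
    using assms c2 c3 c4 c5 c6 c7 c8 c9 c10
    by (intro add_mono mult_right_mono zero_le_power) linarith+
  moreover have "0 < ?p"
  proof -
    have "e^4 \<le> (145/100) * e^3" "e^6 \<le> (145/100) * e^5" "e^7 \<le> 21025/10000 * e^5"
      using assms mult_right_mono[of e "(145/100)" "e^3"] mult_right_mono[of e "(145/100)" "e^5"]
        mult_right_mono[of "e^2" "21025/10000" "e^5"] power_mono[of e "(145/100)" 2]
      by (simp_all add: power_numeral_reduce mult.assoc)
    moreover have "0 \<le> e^5" "0 \<le> e^3" using assms by simp_all
    ultimately have "(3062/10000) - (4213/10000) * e + (208/1000) * e^2 - (418/10000) * e^3 \<le> ?p"
      by linarith
    moreover have "0 < (3062/10000) - (4213/10000) * e + (208/1000) * e^2 - (418/10000) * e^3"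
    proof -
      \<comment> \<open>Expanded at the right end \<open>e = 145/100\<close>, the cubic has only
        positive coefficients in \<open>u\<close>.\<close>
      define u where "u = (145/100) - e"
      have "(3062/10000) - (4213/10000) * e + (208/1000) * e^2 - (418/10000) * e^3
          = (5202475/1000000000) + (817535/10000000) * u + (2617/100000) * u^2 + (418/10000) * u^3"
        unfolding u_def by (simp add: field_simps power2_eq_square power3_eq_cube)
      also have "\<dots> > 0" using assms by (auto simp: u_def intro!: add_pos_nonneg)
      finally show ?thesis .
    qed
    ultimately show ?thesis by linarith
  qed
  ultimately show ?thesis unfolding P_def by linarith
qed

text \<open>This is \<open>critical_trig_small\<close> at \<open>y = pi - e\<close>. As
  \<open>cos y = - cos e\<close>, an upper bound for cos is what is used here.\<close>

lemma critical_trig_large: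
  fixes e :: real
  assumes "0 < e" "e \<le> 145/100"
  shows "(pi\<^sup>2 - (pi - e)\<^sup>2) * (1 + cos e)
    < (pi\<^sup>2/4 - 2) * (pi - e)\<^sup>2 * (1 - cos e) + 4 * (pi - e) * sin e"
proof -
  define C where "C = 1 - e^2/2 + e^4/24 - e^6/720 + e^8/40320"
  define S where "S = e - e^3/6 + e^5/120 - e^7/5040"
  have C: "cos e \<le> C" unfolding C_def using cos_le_Taylor8 assms by simp
  have S: "S \<le> sin e" unfolding S_def using sin_ge_Taylor7 assms by simp
  define A B where "A = pi\<^sup>2 - (pi - e)\<^sup>2" and "B = (pi\<^sup>2/4 - 2) * (pi - e)\<^sup>2"
  have "A = e * (2*pi - e)" unfolding A_def by algebra
  moreover have "e * (2*pi - e) \<ge> 0" using assms pi_gt3 by (intro mult_nonneg_nonneg) auto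
  moreover have "B \<ge> 0" unfolding B_def using pi_squared_bounds by (intro mult_nonneg_nonneg) auto
  ultimately have AB: "0 \<le> A + B" by simp
  have eq: "B * (1 - C) + 4 * (pi - e) * S - A * (1 + C) = e^2 * critical_remainder pi e"
    unfolding A_def B_def C_def S_def by (rule critical_remainder_identity)
  have "0 < B * (1 - C) + 4 * (pi - e) * S - A * (1 + C)"
    unfolding eq by (rule mult_pos_pos) (use critical_remainder_pos[OF assms] assms in simp_all)
  then have "A * (1 - (- C)) < B * (1 + (- C)) + 4 * ((pi - e) * S)"
    by (simp add: algebra_simps)
  moreover have "- C \<le> - cos e" "(pi - e) * S \<le> (pi - e) * sin e"
    using C S assms pi_gt3 by (simp_all add: mult_left_mono)
  ultimately have "A * (1 - (- cos e)) < B * (1 + (- cos e)) + 4 * ((pi - e) * sin e)"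
    using critical_trig_mono[of A "- C" B "(pi - e) * S" "- cos e" "(pi - e) * sin e"] AB by blast
  then show ?thesis unfolding A_def B_def minus_minus mult.assoc diff_minus_eq_add add_uminus_conv_diff .
qed

lemma half_angle_critical:
  fixes p :: real
  assumes "0 < p" "p < pi/2"
  shows "(pi\<^sup>2/4 - p\<^sup>2) * (sin p)\<^sup>2 < (pi\<^sup>2/4 - 2) * p\<^sup>2 * (cos p)\<^sup>2 + 2 * p * (sin p * cos p)"
proof -
  have "(pi\<^sup>2 - (2*p)\<^sup>2) * (1 - cos (2*p))
    < (pi\<^sup>2/4 - 2) * (2*p)\<^sup>2 * (1 + cos (2*p)) + 4 * (2*p) * sin (2*p)"
  \<comment> \<open>The two ranges overlap because \<open>pi - 17/10 < 145/100\<close>.\<close>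
  proof (cases "2*p \<le> 17/10")
    case True
    then show ?thesis using critical_trig_small[of "2*p"] assms by simp
  next
    case False
    then show ?thesis using critical_trig_large[of "pi - 2*p"] assms pi_approx by simp
  qed
  moreover have "1 - cos (2*p) = 2 * (sin p)\<^sup>2" "1 + cos (2*p) = 2 * (cos p)\<^sup>2"
    "sin (2*p) = 2 * (sin p * cos p)"
    by (simp_all add: cos_double sin_double) (simp_all add: cos_squared_eq)
  ultimately have "(pi\<^sup>2 - (2*p)\<^sup>2) * (2 * (sin p)\<^sup>2)
    < (pi\<^sup>2/4 - 2) * (2*p)\<^sup>2 * (2 * (cos p)\<^sup>2) + 4 * (2*p) * (2 * (sin p * cos p))"
    by simp
  then show ?thesis by (simp add: algebra_simps)
qed

section \<open>The critical inequality in terms of p cot p\<close>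

text \<open>Equivalent to \<open>energy p p < (pi\<^sup>2/4 - 1) * (p * cot p)\<^sup>2\<close> for
  the \<open>energy\<close> defined below: no constant angle in \<open>(0, pi/2)\<close> solves the
  recursion.\<close>

lemma cot_critical:
  fixes p :: real
  assumes "0 < p" "p < pi/2"
  shows "(pi\<^sup>2/4 - 1) * (1 - (p * cot p)\<^sup>2) + (1 - p * cot p)\<^sup>2 < p\<^sup>2"
proof -
  have s: "0 < sin p" using assms sin_gt_zero2 by simp
  define x where "x = p * cot p"
  have "p * cos p = x * sin p" using s by (simp add: x_def cot_def)
  then have "(pi\<^sup>2/4 - p\<^sup>2) * (sin p)\<^sup>2 < (pi\<^sup>2/4 - 2) * (x * sin p)\<^sup>2 + 2 * (sin p * (x * sin p))"
    using half_angle_critical[OF assms] unfolding \<open>p * cos p = x * sin p\<close>[symmetric]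
    by (simp add: power_mult_distrib mult_ac)
  then have "(pi\<^sup>2/4 - p\<^sup>2) * (sin p)\<^sup>2 < ((pi\<^sup>2/4 - 2) * x\<^sup>2 + 2 * x) * (sin p)\<^sup>2"
    by (simp add: algebra_simps power2_eq_square)
  then have "pi\<^sup>2/4 - p\<^sup>2 < (pi\<^sup>2/4 - 2) * x\<^sup>2 + 2 * x" using s by simp
  moreover have "(K - 1) * (1 - x\<^sup>2) + (1 - x)\<^sup>2 = K - ((K - 2) * x\<^sup>2 + 2 * x)" for K :: real
    by algebra
  ultimately show ?thesis unfolding x_def[symmetric] by simp
qed

lemma mult_cot_bounds:
  fixes p :: real
  assumes "0 < p" "p \<le> pi/2"
  shows "0 \<le> cot p" "p * cot p \<le> 1"
proof -
  have s: "0 < sin p" using assms by (intro sin_gt_zero) auto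
  have c: "0 \<le> cos p" using assms by (intro cos_ge_zero) auto
  show "0 \<le> cot p" using s c by (simp add: cot_def)
  have "p\<^sup>2 \<le> 2\<^sup>2" using assms pi_less_4 by (intro power_mono) auto
  then have "0 \<le> p^3 * (1/3 - p\<^sup>2/30)" using assms by (intro mult_nonneg_nonneg) auto
  then have "p * cos p \<le> sin p"
    using sin_minus_mult_cos_ge_Taylor[of p] assms by (simp add: algebra_simps flip: power_add)
  then show "p * cot p \<le> 1" using s by (simp add: cot_def)
qed

text \<open>In \<open>t = 1 - p * cot p\<close> and \<open>K = pi\<^sup>2/4\<close>, the left side
  of \<open>cot_critical\<close> is \<open>t * K\<close> plus a nonnegative term. Equality holds at
  \<open>p = pi/2\<close>.\<close>

lemma one_minus_mult_cot_le:
  fixes p :: real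
  assumes "0 < p" "p \<le> pi/2"
  shows "1 - p * cot p \<le> p\<^sup>2 / (pi\<^sup>2/4)"
proof (cases "p = pi/2")
  case True
  show ?thesis unfolding True by (simp add: cot_def power_divide)
next
  case False
  define t where "t = 1 - p * cot p"
  have t: "0 \<le> t" "t \<le> 1" using mult_cot_bounds[OF assms] assms by (auto simp: t_def)
  have "(pi\<^sup>2/4 - 1) * (1 - (1-t)\<^sup>2) + t\<^sup>2 < p\<^sup>2"
    using cot_critical[of p] assms False by (simp add: t_def)
  moreover have "(K - 1) * (1 - (1-t)\<^sup>2) + t\<^sup>2 = t * K + (K - 2) * t * (1 - t)" for K :: real
    by algebra
  ultimately have "t * (pi\<^sup>2/4) + (pi\<^sup>2/4 - 2) * t * (1 - t) < p\<^sup>2" by simp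
  moreover have "0 \<le> (pi\<^sup>2/4 - 2) * t * (1 - t)"
    using t pi_squared_bounds by (intro mult_nonneg_nonneg) auto
  ultimately show ?thesis unfolding t_def[symmetric] by (simp add: field_simps)
qed

subsection \<open>One step of the angle recursion\<close>

text \<open>
  If \<open>\<alpha>\<^sub>t = 2p/\<pi>\<close> and \<open>\<sigma>\<^sub>t = \<alpha>\<^sub>t cot q\<close>, then
  \<open>\<delta> \<sigma>\<^sub>t\<^sub>+\<^sub>1\<^sup>2 = (4/\<pi>\<^sup>2) energy p q\<close>.
\<close>

definition energy :: "real \<Rightarrow> real \<Rightarrow> real" where
  "energy p q = pi\<^sup>2/4 - 1 - q\<^sup>2 + (q - p)\<^sup>2 + (1 - p * cot q)\<^sup>2"

lemma one_plus_cot_squared: "1 + (cot p)\<^sup>2 = 1 / (sin p)\<^sup>2" if "sin p \<noteq> 0" for p :: real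
  using that by (simp add: cot_def field_simps)

text \<open>Convexity of cot: the graph lies above its tangent at \<open>p\<close>.\<close>

lemma cot_diff_le:
  fixes p q :: real
  assumes "0 < p" "p \<le> q" "q \<le> pi/2"
  shows "cot p - cot q \<le> (q - p) * (1 + (cot p)\<^sup>2)"
proof -
  have s: "0 < sin p" "sin p \<le> sin q"
    using assms sin_gt_zero[of p] sin_monotone_2pi_le[of p q] by auto
  then have "cot p - cot q = sin (q - p) / (sin p * sin q)"
    by (simp add: cot_def sin_diff field_simps)
  also have "\<dots> \<le> (q - p) / (sin p * sin p)"
    using s assms by (intro frac_le mult_left_mono sin_x_le_x) auto
  finally show ?thesis using s one_plus_cot_squared[of p] by (simp add: power2_eq_square)
qed

lemma cot_less_iff:
  fixes p q :: real
  assumes "0 < p" "p \<le> pi/2" "0 < q" "q \<le> pi/2"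
  shows "cot q < cot p \<longleftrightarrow> p < q"
proof -
  have less: "cot y < cot x" if "0 < x" "x < y" "y \<le> pi/2" for x y :: real
  proof -
    have "0 < sin x" "0 < sin y" "0 < sin (y - x)" using that sin_gt_zero by auto
    then show ?thesis by (simp add: cot_def sin_diff field_simps)
  qed
  show ?thesis using less[of p q] less[of q p] assms by (cases p q rule: linorder_cases) auto
qed

text \<open>Here \<open>a\<close>, \<open>b\<close>, \<open>K\<close> stand for
  \<open>cot p\<close>, \<open>cot q\<close>, \<open>pi\<^sup>2/4\<close>. At \<open>q = p\<close>
  the claim is the critical inequality. As \<open>q\<close> grows, the tangent bound on
  \<open>a - b\<close> shows that the growth of \<open>(1 - p * b)\<^sup>2\<close> is outweighed by
  the drop of \<open>(q - p)\<^sup>2 - q\<^sup>2\<close> and the growth of the right side.\<close>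

lemma energy_less_aux:
  fixes p q a b K :: real
  assumes "(K - 1) * (1 - (p * a)\<^sup>2) + (1 - p * a)\<^sup>2 < p\<^sup>2"
    and "0 < p" "p \<le> q" "0 \<le> b" "0 \<le> a" "p * b \<le> 1" "b \<le> a" "a - b \<le> (q - p) * (1 + a\<^sup>2)" "2 \<le> K"
  shows "K - 1 - q\<^sup>2 + (q - p)\<^sup>2 + (1 - p * b)\<^sup>2 < (K - 1) * (q * a)\<^sup>2"
proof -
  have "0 \<le> p * a" "0 \<le> p * b" using assms by auto
  then have "2 - p * a - p * b \<le> 2" by linarith
  then have "p * (a - b) * (2 - p * a - p * b) \<le> p * (a - b) * 2"
    using assms by (intro mult_left_mono) auto
  also have "\<dots> \<le> p * ((q - p) * (1 + a\<^sup>2)) * 2"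
    using assms by (intro mult_left_mono mult_right_mono) auto
  also have "\<dots> = 2 * p * (q - p) + 1 * (a\<^sup>2 * (2 * p * (q - p)))" by algebra
  also have "\<dots> \<le> 2 * p * (q - p) + (K - 1) * (a\<^sup>2 * ((q + p) * (q - p)))"
    using assms by (intro add_left_mono mult_mono mult_left_mono mult_right_mono mult_nonneg_nonneg) auto
  finally have "p * (a - b) * (2 - p * a - p * b) \<le> 2 * p * (q - p) + (K - 1) * (a\<^sup>2 * ((q + p) * (q - p)))" .
  moreover have "(K - 1) * (q * a)\<^sup>2 - (K - 1 - q\<^sup>2 + (q - p)\<^sup>2 + (1 - p * b)\<^sup>2)
     = (p\<^sup>2 - ((K - 1) * (1 - (p * a)\<^sup>2) + (1 - p * a)\<^sup>2))
      + (2 * p * (q - p) + (K - 1) * (a\<^sup>2 * ((q + p) * (q - p))) - p * (a - b) * (2 - p * a - p * b))"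
    by algebra
  ultimately show ?thesis using assms(1) by linarith
qed

text \<open>The source of claim (ii): if \<open>\<delta> * (q * cot w)\<^sup>2 = energy p q\<close>
  for the next angle \<open>w\<close>, the bound forces \<open>cot w < cot p\<close>.\<close>

lemma energy_less:
  assumes "0 < p" "p \<le> q" "q \<le> pi/2" "p < pi/2"
  shows "energy p q < (pi\<^sup>2/4 - 1) * (q * cot p)\<^sup>2"
  unfolding energy_def
proof (rule energy_less_aux)
  show "p * cot q \<le> 1"
    using mult_cot_bounds[of q] assms mult_right_mono[of p q "cot q"] by simp
  show "cot q \<le> cot p" using cot_less_iff[of q p] assms by force
  show "2 \<le> pi\<^sup>2/4" using pi_squared_bounds by simp
qed (use assms cot_critical[of p] mult_cot_bounds cot_diff_le in auto)

text \<open>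
  Minimising over \<open>p\<close> gives a lower bound for \<open>\<sigma>\<^sub>t\<^sub>+\<^sub>1\<^sup>2\<close> that depends only on
  \<open>\<alpha>\<^sub>t\<^sub>+\<^sub>1\<close>. It is what limits the size of an increase of the angle that can be followed by a decrease.
\<close>

lemma energy_ge:
  assumes "0 < q" "q \<le> pi/2"
  shows "pi\<^sup>2/4 - 1 - q\<^sup>2 + (sin q - q * cos q)\<^sup>2 \<le> energy p q"
proof -
  define u where "u = 1 - p * cot q"
  have s: "0 < sin q" using assms sin_gt_zero by auto
  \<comment> \<open>This combination of \<open>u\<close> and \<open>q - p\<close> does not depend on
    \<open>p\<close>; Lagrange's identity bounds its square by the sum of their squares.\<close>
  have "sin q - q * cos q = sin q * u - cos q * (q - p)"
    using s by (simp add: u_def cot_def field_simps)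
  moreover have "(sin q * u - cos q * (q - p))\<^sup>2 + (cos q * u + sin q * (q - p))\<^sup>2
      = ((sin q)\<^sup>2 + (cos q)\<^sup>2) * (u\<^sup>2 + (q - p)\<^sup>2)" by algebra
  moreover have "x \<le> z" if "x + y\<^sup>2 = 1 * z" for x y z :: real using that zero_le_power2[of y] by linarith
  ultimately have "(sin q - q * cos q)\<^sup>2 \<le> u\<^sup>2 + (q - p)\<^sup>2" by (metis sin_cos_squared_add)
  then show ?thesis by (simp add: energy_def u_def)
qed

section \<open>Decreases small enough to be followed by an increase\<close>

text \<open>As a convex quadratic in \<open>q\<close>, \<open>energy q w\<close> takes its value at
  \<open>q = w\<close> again at the upper end of the given interval. In between it is at most
  \<open>energy w w\<close>, and \<open>cot_critical\<close> applies.\<close>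

lemma energy_less_if_small_decrease:
  assumes "0 < w" "w \<le> q" "w < pi/2" and "q \<le> w + 2 * cos w * (sin w - w * cos w)"
  shows "energy q w < (pi\<^sup>2/4 - 1) * (w * cot w)\<^sup>2"
proof -
  define a where "a = cot w"
  have s: "0 < sin w" using assms sin_gt_zero by auto
  have "q * (1 + a\<^sup>2) \<le> (w + 2 * cos w * (sin w - w * cos w)) * (1 + a\<^sup>2)"
    using assms by (intro mult_right_mono) auto
  also have "\<dots> = w * (1 + a\<^sup>2) + (2 * cos w * (sin w - w * cos w)) / (sin w)\<^sup>2"
    using one_plus_cot_squared[of w] s by (simp add: a_def distrib_right add_divide_distrib)
  also have "\<dots> = w * (1 + a\<^sup>2) + 2 * a * (1 - w * a)"
    using s by (simp add: a_def cot_def field_simps power2_eq_square)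
  finally have "(q - w) * ((q - w) - 2 * a + (q + w) * a\<^sup>2) \<le> 0"
    using assms by (intro mult_nonneg_nonpos) (auto simp: algebra_simps power2_eq_square)
  moreover have "K - 1 - w\<^sup>2 + (w - q)\<^sup>2 + (1 - q * a)\<^sup>2
     = (K - 1 - w\<^sup>2 + (1 - w * a)\<^sup>2) + (q - w) * ((q - w) - 2 * a + (q + w) * a\<^sup>2)" for K :: real
    by algebra
  moreover have "(K - 1) * (w * a)\<^sup>2 = K - 1 - (K - 1) * (1 - (w * a)\<^sup>2)" for K :: real
    by algebra
  ultimately show ?thesis
    using cot_critical[of w] assms unfolding energy_def a_def[symmetric] by simp
qed

text \<open>Near \<open>pi/2\<close> the allowance admits every \<open>q \<le> pi/2\<close>. With
  \<open>e = pi/2 - w\<close> the proof uses \<open>pi * (sin e * cos e) \<le> 1\<close>, whence the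
  cutoff \<open>1/pi\<close>.\<close>

lemma overshoot_allowance_ge_pi_half:
  assumes "pi/2 - 1/pi \<le> w" "w < pi/2"
  shows "pi/2 \<le> w + 2 * cos w * (sin w - w * cos w)"
proof -
  define e where "e = pi/2 - w"
  have e: "0 < e" "e \<le> 1/pi" using assms by (auto simp: e_def)
  have w: "w = pi/2 - e" by (simp add: e_def)
  have e1: "e \<le> 1/3" using e pi_gt3 by (smt (verit) frac_le)
  define s c where "s = sin e" and "c = cos e"
  have sc: "s\<^sup>2 + c\<^sup>2 = 1" by (simp add: s_def c_def)
  have s: "0 < s" "s \<le> e" using e e1 pi_gt3 sin_gt_zero[of e] sin_x_le_x[of e] by (auto simp: s_def)
  have c: "0 < c" "c \<le> 1" using e e1 pi_gt3 cos_gt_zero[of e] by (auto simp: c_def)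
  have "e * c \<le> s"
    using mult_cot_bounds(2)[of e] e e1 pi_gt3 s by (simp add: s_def c_def cot_def field_simps)
  moreover have "s\<^sup>2 \<le> (1/3)\<^sup>2" using s e1 by (intro power_mono) auto
  then have "0 \<le> 2 * c\<^sup>2 - 1" using sc by (simp add: power2_eq_square)
  ultimately have "e * c * (2 * c\<^sup>2 - 1) \<le> s * (2 * c\<^sup>2 - 1)" by (intro mult_right_mono)
  moreover have "s * (pi * (s * c)) \<le> s * 1"
  proof (intro mult_left_mono)
    have "s * c \<le> 1/pi * 1" using s c e by (intro mult_mono) auto
    then show "pi * (s * c) \<le> 1" by (simp add: field_simps)
  qed (use s in auto)
  ultimately have "c * (e * (2 * c\<^sup>2 - 1)) \<le> c * (2 * s * c - pi * s\<^sup>2)"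
    by (simp add: algebra_simps power2_eq_square)
  then have "e * (2 * c\<^sup>2 - 1) \<le> 2 * s * c - pi * s\<^sup>2" using c by simp
  moreover have "2 * c\<^sup>2 - 1 = 1 - 2 * s\<^sup>2" using sc by simp
  ultimately have "e * (1 - 2 * s\<^sup>2) \<le> 2 * s * c - pi * s\<^sup>2" by simp
  then have "e \<le> 2 * s * (c - (pi/2 - e) * s)"
    by (simp add: algebra_simps power2_eq_square)
  then show ?thesis unfolding w by (simp add: s_def c_def sin_diff cos_diff)
qed

text \<open>With \<open>overshoot_allowance_ge_const\<close> this covers all \<open>w\<close> below
  \<open>pi/2 - 1/pi < 12526/10000\<close>; the two bounds agree at \<open>w = 1\<close>.\<close>

lemma overshoot_allowance_ge_cubic:
  fixes w :: real
  assumes "0 < w" "w \<le> 1"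
  shows "312/1000 * w^3 \<le> 2 * cos w * (sin w - w * cos w)"
proof -
  have w2: "w\<^sup>2 \<le> 1" using assms by (auto intro: power_le_one)
  have "w^6 \<le> w^2" using assms by (auto intro: power_decreasing)
  moreover have "0 \<le> (1 - w^2)^2" by simp
  then have "2 * w^2 - 1 \<le> w^4" by (simp add: power2_diff flip: power_mult)
  ultimately have c: "53/100 \<le> cos w"
    using cos_ge_Taylor6[of w] assms w2 by auto
  have "w^3 * (3/10) \<le> w^3 * (1/3 - w\<^sup>2/30)" using w2 assms by (intro mult_left_mono) auto
  also have "\<dots> \<le> sin w - w * cos w"
    using sin_minus_mult_cos_ge_Taylor[of w] assms by (simp add: algebra_simps flip: power_add)
  finally have "w^3 * (3/10) \<le> sin w - w * cos w" .
  then have "53/100 * (w^3 * (3/10)) \<le> cos w * (sin w - w * cos w)"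
    using c assms by (intro mult_mono) auto
  moreover have "312/1000 * w^3 \<le> 2 * (53/100 * (w^3 * (3/10)))" using assms by simp
  ultimately show ?thesis by linarith
qed

text \<open>The tangent of \<open>x^3/3 - x^5/30\<close> at \<open>x = 1\<close>, with its slope
  \<open>5/6\<close> rounded down.\<close>

lemma sin_minus_mult_cos_ge_linear:
  fixes w :: real
  assumes "1 \<le> w" "w \<le> 13/10"
  shows "3/10 + 83/100 * (w - 1) \<le> sin w - w * cos w"
proof -
  define h where "h = w - 1"
  have h: "0 \<le> h" "h \<le> 3/10" "w = 1 + h" using assms by (auto simp: h_def)
  have "w^3/3 - w^5/30 = 3/10 + 5/6 * h + (2/3 - h^2/6 - h^3/30) * h\<^sup>2"
    unfolding h(3) by (simp add: field_simps power_numeral_reduce)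
  moreover have "h^2 \<le> 1" "h^3 \<le> 1" using h by (auto intro: power_le_one)
  then have "0 \<le> (2/3 - h^2/6 - h^3/30) * h\<^sup>2" by (intro mult_nonneg_nonneg) auto
  ultimately show ?thesis
    using sin_minus_mult_cos_ge_Taylor[of w] assms h by (simp add: h_def[symmetric])
qed

lemma overshoot_allowance_ge_const:
  fixes w :: real
  assumes "1 \<le> w" "w \<le> 12526/10000"
  shows "312/1000 \<le> 2 * cos w * (sin w - w * cos w)"
proof -
  define h where "h = w - 1"
  have h: "0 \<le> h" "h \<le> 2526/10000" "w = 1 + h" using assms by (auto simp: h_def)
  have "1 - w^2/2 + w^4/24 - w^6/720
     = 389/720 - 101/120 * h - 13/48 * (h * h) + (5/36 + h/48 - h^2/120 - h^3/720) * h^3"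
    unfolding h(3) by (simp add: field_simps power_numeral_reduce)
  moreover have "h^2 \<le> 1" "h^3 \<le> 1" using h by (auto intro: power_le_one)
  then have "0 \<le> (5/36 + h/48 - h^2/120 - h^3/720) * h^3" using h by (intro mult_nonneg_nonneg) auto
  moreover have hh: "h * h \<le> 2526/10000 * h" using h by (intro mult_right_mono) auto
  ultimately have "54/100 - 92/100 * h \<le> cos w"
    using cos_ge_Taylor6[of w] assms h by simp
  moreover have "3/10 + 83/100 * h \<le> sin w - w * cos w"
    using sin_minus_mult_cos_ge_linear[of w] assms by (simp add: h_def)
  ultimately have "(54/100 - 92/100 * h) * (3/10 + 83/100 * h) \<le> cos w * (sin w - w * cos w)"
    using h cos_ge_zero[of w] assms pi_gt3 by (intro mult_mono) auto
  moreover have "156/1000 \<le> (54/100 - 92/100 * h) * (3/10 + 83/100 * h)"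
    using h hh by (simp add: algebra_simps)
  ultimately show ?thesis by simp
qed

section \<open>The size of an increase that is followed by a decrease\<close>

text \<open>The inequality of \<open>energy_excess_le_small\<close> divided by
  \<open>p\<^sup>2\<close>, with \<open>l = (q - p) / p\<close>, \<open>P = p\<^sup>2\<close> and
  \<open>u = 1 - p * cot q\<close>.\<close>

lemma energy_excess_le_ratio:
  fixes l K P u :: real
  assumes "0 \<le> l" "0 < P" "P \<le> 1" "312/1000 * P \<le> l" "0 \<le> u" "u \<le> 1" "246/100 \<le> K"
    and u: "u \<le> P * (1 + l)\<^sup>2 / K + l / (1 + l)"
  shows "l\<^sup>2 * P + u\<^sup>2 \<le> (2 * l + l\<^sup>2) * (K - 1)"
proof -
  have K: "(2 * l + l\<^sup>2) * (146/100) \<le> (2 * l + l\<^sup>2) * (K - 1)"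
    using assms by (intro mult_left_mono) auto
  have lP: "l\<^sup>2 * P \<le> l\<^sup>2 * 1" using assms by (intro mult_left_mono) auto
  have bound: "u \<le> v" if "P \<le> a" "l \<le> b" "0 \<le> b" "a * (1 + b)\<^sup>2 / (246/100) + b / (1 + b) \<le> v" for a b v
  proof -
    have "P * (1 + l)\<^sup>2 / K \<le> a * (1 + b)\<^sup>2 / (246/100)"
      using assms that by (intro frac_le mult_mono power_mono) auto
    moreover have "l / (1 + l) \<le> b / (1 + b)" using that assms by (simp add: field_simps)
    ultimately show ?thesis using u that by linarith
  qed
  have u2: "u\<^sup>2 \<le> v\<^sup>2" if "u \<le> v" for v using assms that by (intro power_mono) auto
  have l2: "c\<^sup>2 \<le> l\<^sup>2" if "c \<le> l" "0 \<le> c" for c using that by (intro power_mono) auto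
  \<comment> \<open>For large \<open>l\<close>, \<open>u \<le> 1\<close> suffices; for small
    \<open>l\<close>, \<open>P \<le> 1000/312 * l\<close> makes the bound on \<open>u\<close> linear
    in \<open>l\<close>. On the two bands between, that bound is evaluated at the right end.\<close>
  consider "33/100 \<le> l" | "31/100 \<le> l" "l \<le> 33/100" | "29/100 \<le> l" "l \<le> 31/100" | "l \<le> 29/100"
    by linarith
  then have "l\<^sup>2 + u\<^sup>2 \<le> (2 * l + l\<^sup>2) * (146/100)"
  proof cases
    case 1
    have "u\<^sup>2 \<le> 1" using assms by (auto intro: power_le_one)
    then show ?thesis using l2[of "33/100"] 1 by (simp add: power2_eq_square)
  next
    case 2
    have "u \<le> 968/1000" using 2 assms by (intro bound[of 1 "33/100"]) (auto simp: power2_eq_square)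
    from u2[OF this] show ?thesis using l2[of "31/100"] 2 by (simp add: power2_eq_square)
  next
    case 3
    have "u \<le> 931/1000" using 3 assms by (intro bound[of "994/1000" "31/100"]) (auto simp: power2_eq_square)
    from u2[OF this] show ?thesis using l2[of "29/100"] 3 by (simp add: power2_eq_square)
  next
    case 4
    have "P * (1 + l)\<^sup>2 / K \<le> (1000/312 * l) * (129/100)\<^sup>2 / (246/100)"
      using assms 4 by (intro frac_le mult_mono power_mono) auto
    moreover have "l / (1 + l) \<le> l" using assms by (simp add: field_simps)
    ultimately have "u \<le> 317/100 * l" using u assms by (simp add: power2_eq_square)
    from u2[OF this] have "u\<^sup>2 \<le> (317/100)\<^sup>2 * (l * l)" by (simp add: power2_eq_square)
    also have "\<dots> \<le> 1005/100 * (l * l)" by (intro mult_right_mono) (auto simp: power2_eq_square)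
    finally have "u\<^sup>2 \<le> 1005/100 * (l * l)" .
    moreover have "l * l \<le> 29/100 * l" using 4 assms by (intro mult_right_mono) auto
    ultimately have "l * l + u\<^sup>2 \<le> 2 * (146/100) * l + 146/100 * (l * l)" using assms(1) by simp
    then show ?thesis by (simp add: power2_eq_square distrib_right)
  qed
  then show ?thesis using K lP by linarith
qed

text \<open>\<open>1 - p * cot q\<close> splits into \<open>1 - q * cot q\<close>, bounded by
  \<open>one_minus_mult_cot_le\<close>, and \<open>(q - p) * cot q\<close>, bounded by
  \<open>(q - p) / q\<close>. The result contradicts \<open>excess_if_decrease\<close>.\<close>

lemma energy_excess_le_small:
  fixes p q :: real
  assumes "0 < p" "p \<le> 1" "q \<le> pi/2" "312/1000 * p^3 \<le> q - p"
  shows "p\<^sup>2 * (q - p)\<^sup>2 + p\<^sup>2 * (1 - p * cot q)\<^sup>2 \<le> (pi\<^sup>2/4 - 1) * (q\<^sup>2 - p\<^sup>2)"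
proof -
  define l where "l = (q - p) / p"
  define u where "u = 1 - p * cot q"
  define K where "K = pi\<^sup>2/4"
  have K: "246/100 \<le> K" using pi_squared_bounds by (simp add: K_def)
  have q: "q = p * (1 + l)" using assms by (simp add: l_def field_simps)
  have "0 \<le> 312/1000 * p^3" using assms by simp
  then have "p \<le> q" using assms by linarith
  then have l: "0 \<le> l" "0 < q" using assms by (auto simp: l_def)
  have cot: "0 \<le> cot q" "q * cot q \<le> 1" using mult_cot_bounds[of q] l assms by auto
  have "l\<^sup>2 * p\<^sup>2 + u\<^sup>2 \<le> (2 * l + l\<^sup>2) * (K - 1)"
  proof (rule energy_excess_le_ratio)
    show "312/1000 * p\<^sup>2 \<le> l"
      using assms by (simp add: l_def field_simps power2_eq_square power3_eq_cube)
    show "p\<^sup>2 \<le> 1" using assms by (auto intro: power_le_one)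
    show "0 \<le> u" using cot mult_right_mono[OF \<open>p \<le> q\<close> cot(1)] by (simp add: u_def)
    show "u \<le> 1" using cot assms by (simp add: u_def)
    have "u = (1 - q * cot q) + (q - p) * cot q" by (simp add: u_def algebra_simps)
    also have "\<dots> \<le> q\<^sup>2 / K + (q - p) * (1 / q)"
      using one_minus_mult_cot_le[of q] l assms cot \<open>p \<le> q\<close> unfolding K_def
      by (intro add_mono mult_left_mono) (auto simp: field_simps)
    also have "(q - p) * (1 / q) = l / (1 + l)" using l assms by (simp add: q field_simps)
    finally show "u \<le> p\<^sup>2 * (1 + l)\<^sup>2 / K + l / (1 + l)" by (simp add: q power_mult_distrib)
  qed (use l K assms in auto)
  then have "p\<^sup>2 * (l\<^sup>2 * p\<^sup>2 + u\<^sup>2) \<le> p\<^sup>2 * ((2 * l + l\<^sup>2) * (K - 1))" by (intro mult_left_mono) auto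
  moreover have "p\<^sup>2 * (l\<^sup>2 * p\<^sup>2 + u\<^sup>2) = p\<^sup>2 * (q - p)\<^sup>2 + p\<^sup>2 * u\<^sup>2"
    "p\<^sup>2 * ((2 * l + l\<^sup>2) * (K - 1)) = (K - 1) * (q\<^sup>2 - p\<^sup>2)" unfolding q by algebra+
  ultimately show ?thesis unfolding u_def K_def by simp
qed

text \<open>The term with \<open>(sin p - p * cos p)\<^sup>2\<close> makes the crude bound
  \<open>u \<le> 1\<close> sufficient; what remains is a quadratic inequality in
  \<open>h = p - 1\<close>.\<close>

lemma energy_excess_le_large:
  fixes p q :: real
  assumes "1 \<le> p" "q \<le> pi/2" "312/1000 \<le> q - p"
  shows "p\<^sup>2 * (q - p)\<^sup>2 + p\<^sup>2 * (1 - p * cot q)\<^sup>2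
    \<le> (pi\<^sup>2/4 - 1) * (q\<^sup>2 - p\<^sup>2) + q\<^sup>2 * (sin p - p * cos p)\<^sup>2"
proof -
  define d where "d = q - p"
  define h where "h = p - 1"
  define u where "u = 1 - p * cot q"
  define g where "g = sin p - p * cos p"
  have ph: "p = 1 + h" "0 \<le> h" using assms by (auto simp: h_def)
  have qd: "q = p + d" "312/1000 \<le> d" using assms by (auto simp: d_def)
  have p: "p \<le> 13/10" using assms pi_approx by auto
  have cot: "0 \<le> cot q" "q * cot q \<le> 1" using mult_cot_bounds[of q] assms by auto
  have "p * cot q \<le> q * cot q" "0 \<le> p * cot q" using assms cot by (auto intro: mult_right_mono)
  then have "0 \<le> u" "u \<le> 1" using cot by (auto simp: u_def)
  then have u: "p\<^sup>2 * u\<^sup>2 \<le> p\<^sup>2 * 1" by (intro mult_left_mono) (auto intro: power_le_one)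
  have "0 \<le> p * d" using assms by (simp add: d_def)
  have "q\<^sup>2 \<le> (pi/2)\<^sup>2" using assms by (intro power_mono) auto
  then have "q\<^sup>2 \<le> 2468/1000" using pi_squared_bounds by (simp add: power_divide)
  \<comment> \<open>Hence \<open>p * d \<le> q\<^sup>2/4\<close>.\<close>
  moreover have "q\<^sup>2 = (p - d)\<^sup>2 + 4 * (p * d)" unfolding qd by algebra
  ultimately have "p * d \<le> 617/1000" using zero_le_power2[of "p - d"] by linarith
  then have "(p * d) * (p * d) \<le> 617/1000 * (p * d)" using \<open>0 \<le> p * d\<close> by (intro mult_right_mono)
  then have pd: "p\<^sup>2 * d\<^sup>2 \<le> 617/1000 * (p * d)" by (simp add: power2_eq_square mult_ac)
  have K: "146/100 * (q\<^sup>2 - p\<^sup>2) \<le> (pi\<^sup>2/4 - 1) * (q\<^sup>2 - p\<^sup>2)"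
    using assms pi_squared_bounds by (intro mult_right_mono) (auto intro: power_mono)
  have "3/10 + 83/100 * h \<le> g"
    using sin_minus_mult_cos_ge_linear[of p] assms p by (simp add: g_def h_def)
  then have "(1312/1000 + h) * (3/10 + 83/100 * h) \<le> q * g"
    using ph qd by (intro mult_mono) auto
  then have "((1312/1000 + h) * (3/10 + 83/100 * h))\<^sup>2 \<le> (q * g)\<^sup>2"
    using ph by (intro power_mono) auto
  moreover have "1549/10000 + 109/100 * h + 2577/1000 * (h * h) \<le> ((1312/1000 + h) * (3/10 + 83/100 * h))\<^sup>2"
  proof -
    have "((1312/1000 + h) * (3/10 + 83/100 * h))\<^sup>2
      = (3936/10000)\<^sup>2 + 2 * (3936/10000) * (138896/100000) * h + ((138896/100000)\<^sup>2 + 2 * (3936/10000) * (83/100)) * (h * h)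
        + (2 * (138896/100000) * (83/100) + (83/100)\<^sup>2 * h) * (h * (h * h))"
      by (simp add: field_simps power2_eq_square)
    moreover have "0 \<le> (2 * (138896/100000) * (83/100) + (83/100)\<^sup>2 * h) * (h * (h * h))"
      using ph by (intro mult_nonneg_nonneg) auto
    moreover have "1549/10000 + 109/100 * h + 2577/1000 * (h * h) \<le>
        (3936/10000)\<^sup>2 + 2 * (3936/10000) * (138896/100000) * h
        + ((138896/100000)\<^sup>2 + 2 * (3936/10000) * (83/100)) * (h * h)"
      by (intro add_mono mult_right_mono) (use ph(2) in \<open>auto simp: power2_eq_square\<close>)
    ultimately show ?thesis by (simp only: add_increasing2)
  qed
  ultimately have g: "1549/10000 + 109/100 * h + 2577/1000 * (h * h) \<le> q\<^sup>2 * g\<^sup>2"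
    by (simp add: power_mult_distrib)
  have q2: "q\<^sup>2 - p\<^sup>2 = 2 * (p * d) + d\<^sup>2" unfolding qd by algebra
  have "(312/1000)\<^sup>2 \<le> d\<^sup>2" using qd by (intro power_mono) auto
  then have d2: "973/10000 \<le> d\<^sup>2" by (simp add: power2_eq_square)
  have pd1: "p * (312/1000) \<le> p * d" using qd assms by (intro mult_left_mono) auto
  define H where "H = h * h"
  \<comment> \<open>The difference of the two sides is smallest near \<open>h = 6/100\<close>, so
    \<open>H\<close> is replaced by its tangent there.\<close>
  have "0 \<le> (h - 6/100)\<^sup>2" by simp
  then have "12/100 * h - 36/10000 \<le> H" by (simp add: H_def power2_eq_square algebra_simps)
  moreover have "p\<^sup>2 = 1 + 2 * h + H" by (simp add: ph(1) H_def power2_eq_square algebra_simps)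
  moreover have "h \<le> 3/10" using ph p by simp
  \<comment> \<open>\<open>2303/1000\<close> is \<open>2 * (146/100) - 617/1000\<close>, the weight
    of \<open>p * d\<close> left after using \<open>pd\<close>.\<close>
  ultimately have "p\<^sup>2 \<le> 2303/1000 * (p * (312/1000)) + 146/100 * (973/10000)
      + (1549/10000 + 109/100 * h + 2577/1000 * H)"
    using ph by linarith
  moreover have "a + b \<le> c + e"
    if "x \<le> 2303/1000 * r + 146/100 * s + t" "b \<le> x * 1" "a \<le> 617/1000 * v"
      "146/100 * (2 * v + y) \<le> c" "t \<le> e" "s \<le> y" "r \<le> v" for a b c e x r s t v y :: real
    using that unfolding distrib_left by linarith
  ultimately show ?thesis
    using u pd K g d2 pd1 unfolding H_def q2 g_def[symmetric] u_def[symmetric] d_def[symmetric] by blast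
qed

text \<open>A decrease makes \<open>energy p q\<close> exceed
  \<open>\<delta> * (q * cot q)\<^sup>2\<close>, which is \<open>(q / p)\<^sup>2\<close> times the
  quantity bounded in \<open>lower\<close>.\<close>

lemma excess_if_decrease:
  assumes "0 < p" "p \<le> q" "q \<le> pi/2" "0 < w" "w < q"
    and d: "0 < \<delta>"
    and lower: "pi\<^sup>2/4 - 1 - p\<^sup>2 + (sin p - p * cos p)\<^sup>2 \<le> \<delta> * (p * cot q)\<^sup>2"
    and step: "\<delta> * (q * cot w)\<^sup>2 = energy p q"
  shows "(pi\<^sup>2/4 - 1) * (q\<^sup>2 - p\<^sup>2) + q\<^sup>2 * (sin p - p * cos p)\<^sup>2
    < p\<^sup>2 * (q - p)\<^sup>2 + p\<^sup>2 * (1 - p * cot q)\<^sup>2"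
proof -
  define K g u where "K = pi\<^sup>2/4" and "g = sin p - p * cos p" and "u = 1 - p * cot q"
  have "cot q < cot w" using cot_less_iff[of w q] assms by simp
  moreover have "0 \<le> cot q" using mult_cot_bounds assms by simp
  ultimately have "(q * cot q)\<^sup>2 < (q * cot w)\<^sup>2"
    using assms by (intro power_strict_mono mult_strict_left_mono) auto
  then have "p\<^sup>2 * (\<delta> * (q * cot q)\<^sup>2) < p\<^sup>2 * (\<delta> * (q * cot w)\<^sup>2)"
    using d \<open>0 < p\<close> by (intro mult_strict_left_mono) auto
  moreover have "q\<^sup>2 * (K - 1 - p\<^sup>2 + g\<^sup>2) \<le> q\<^sup>2 * (\<delta> * (p * cot q)\<^sup>2)"
    using lower by (intro mult_left_mono) (auto simp: K_def g_def)
  moreover have "p\<^sup>2 * (\<delta> * (q * cot q)\<^sup>2) = q\<^sup>2 * (\<delta> * (p * cot q)\<^sup>2)" by algebra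
  ultimately have "q\<^sup>2 * (K - 1 - p\<^sup>2 + g\<^sup>2) < p\<^sup>2 * energy p q" unfolding step by linarith
  then have "q\<^sup>2 * (K - 1 - p\<^sup>2 + g\<^sup>2) < p\<^sup>2 * (K - 1 - q\<^sup>2 + (q - p)\<^sup>2 + u\<^sup>2)"
    by (simp add: energy_def K_def u_def)
  moreover have "p\<^sup>2 * (K - 1 - q\<^sup>2 + (q - p)\<^sup>2 + u\<^sup>2) - q\<^sup>2 * (K - 1 - p\<^sup>2 + g\<^sup>2)
    = (p\<^sup>2 * (q - p)\<^sup>2 + p\<^sup>2 * u\<^sup>2) - ((K - 1) * (q\<^sup>2 - p\<^sup>2) + q\<^sup>2 * g\<^sup>2)" by algebra
  ultimately show ?thesis unfolding K_def g_def u_def by linarith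
qed

section \<open>Claims (ii) and (iii) for consecutive angles\<close>

lemma increase_after_step:
  assumes "0 < p" "p \<le> q" "q \<le> pi/2" "p < pi/2" "0 < w" "w \<le> pi/2"
    and d: "pi\<^sup>2/4 - 1 < \<delta>" and step: "\<delta> * (q * cot w)\<^sup>2 = energy p q"
  shows "p < w"
proof (rule ccontr)
  assume "\<not> p < w"
  then have "cot p \<le> cot w" using cot_less_iff[of p w] assms by force
  then have "(q * cot p)\<^sup>2 \<le> (q * cot w)\<^sup>2"
    using assms mult_cot_bounds[of p] by (intro power_mono mult_left_mono mult_nonneg_nonneg) auto
  then have "(pi\<^sup>2/4 - 1) * (q * cot p)\<^sup>2 \<le> \<delta> * (q * cot w)\<^sup>2"
    using d pi_squared_bounds by (intro mult_mono) auto
  then show False using energy_less[of p q] assms by simp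
qed

text \<open>Claim (iii). By (ii), \<open>p < w\<close>, so the decrease \<open>q - w\<close> is
  smaller than the increase \<open>q - p\<close>. It stays within the allowance at \<open>w\<close>,
  after which \<open>energy_less_if_small_decrease\<close> excludes a second decrease.
  \<open>lower\<close> is what \<open>energy_ge\<close> gives for the step leading to
  \<open>q\<close>.\<close>

lemma no_two_decreases:
  assumes "0 < p" "p \<le> q" "q \<le> pi/2" "0 < w" "w < q" "0 < z" "z \<le> pi/2"
    and d: "pi\<^sup>2/4 - 1 < \<delta>"
    and lower: "pi\<^sup>2/4 - 1 - p\<^sup>2 + (sin p - p * cos p)\<^sup>2 \<le> \<delta> * (p * cot q)\<^sup>2"
    and step1: "\<delta> * (q * cot w)\<^sup>2 = energy p q"
    and step2: "\<delta> * (w * cot z)\<^sup>2 = energy q w"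
  shows "w \<le> z"
proof -
  have dpos: "0 < \<delta>" using d pi_squared_bounds by simp
  \<comment> \<open>Otherwise \<open>q = pi/2\<close> as well, the energy vanishes, and
    \<open>w < q\<close> is impossible.\<close>
  have "p < pi/2"
  proof (rule ccontr)
    assume "\<not> p < pi/2"
    then have "p = pi/2" "q = pi/2" using assms by auto
    then have "energy p q = energy (pi/2) (pi/2)" by (simp only:)
    also have "\<dots> = 0" by (simp add: energy_def cot_def power_divide)
    finally have "energy p q = 0" .
    moreover have "0 < cot w" using assms mult_cot_bounds(1)[of q] cot_less_iff[of w q] by force
    ultimately show False using step1 dpos assms by simp
  qed
  then have pw: "p < w" using increase_after_step[of p q w] assms by simp
  have "q \<le> w + 2 * cos w * (sin w - w * cos w)"
  proof (cases "pi/2 - 1/pi \<le> w")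
    case True
    then show ?thesis using overshoot_allowance_ge_pi_half[of w] assms by simp
  next
    case False
    have "1000/3142 \<le> 1/pi" using pi_approx by (simp add: field_simps)
    then have w: "w \<le> 12526/10000" using False pi_approx by simp
    show ?thesis
    proof (rule ccontr)
      \<comment> \<open>The increase from \<open>p\<close> to \<open>q\<close> would be so large that the next step could not be a decrease.\<close>
      assume "\<not> ?thesis"
      then have gap: "2 * cos w * (sin w - w * cos w) \<le> q - p" using pw by simp
      have "p\<^sup>2 * (q - p)\<^sup>2 + p\<^sup>2 * (1 - p * cot q)\<^sup>2
          \<le> (pi\<^sup>2/4 - 1) * (q\<^sup>2 - p\<^sup>2) + q\<^sup>2 * (sin p - p * cos p)\<^sup>2"
      \<comment> \<open>As \<open>p < w\<close>, the allowance at \<open>w\<close> is at least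
        \<open>312/1000 * p^3\<close> if \<open>p \<le> 1\<close>, and at least
        \<open>312/1000\<close> otherwise.\<close>
      proof (cases "p \<le> 1")
        case True
        have "312/1000 * p^3 \<le> q - p"
        proof (cases "w \<le> 1")
          case True
          have "p^3 \<le> w^3" using pw assms by (intro power_mono) auto
          then show ?thesis using overshoot_allowance_ge_cubic[of w] True assms gap by linarith
        next
          case False
          have "p^3 \<le> 1" using \<open>p \<le> 1\<close> assms by (auto intro: power_le_one)
          then show ?thesis using overshoot_allowance_ge_const[of w] False w gap by linarith
        qed
        then show ?thesis
          using energy_excess_le_small[of p q] True assms zero_le_power2[of "q * (sin p - p * cos p)"]
          unfolding power_mult_distrib by linarith
      next
        case False
        then show ?thesis
          using energy_excess_le_large[of p q] overshoot_allowance_ge_const[of w] w gap pw assms by simp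
      qed
      then show False using excess_if_decrease[of p q w \<delta>] assms dpos by simp
    qed
  qed
  then have "energy q w < (pi\<^sup>2/4 - 1) * (w * cot w)\<^sup>2"
    using energy_less_if_small_decrease[of w q] assms by simp
  also have "\<dots> \<le> \<delta> * (w * cot w)\<^sup>2" using d by (intro mult_right_mono) auto
  finally have "\<delta> * (w * cot z)\<^sup>2 < \<delta> * (w * cot w)\<^sup>2" using step2 by simp
  then have "(w * cot z)\<^sup>2 < (w * cot w)\<^sup>2" using dpos by simp
  then have "w * cot z < w * cot w"
    by (rule power_less_imp_less_base) (use assms mult_cot_bounds in auto)
  then have "cot z < cot w" using assms by simp
  then show ?thesis using cot_less_iff[of w z] assms by simp
qed

subsection \<open>Convergence\<close>

lemma cos_plus_mult_sin_le:
  assumes "0 \<le> q" "q \<le> pi/2"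
  shows "cos q + q * sin q \<le> pi/2"
proof -
  define e where "e = pi/2 - q"
  have e: "0 \<le> e" "e \<le> pi/2" and q: "q = pi/2 - e" using assms by (auto simp: e_def)
  have "e * (1 - cos e) \<le> pi/2 * (1 - cos e)" using e by (intro mult_right_mono) auto
  moreover have "sin e \<le> e" using e by (intro sin_x_le_x) auto
  ultimately show ?thesis unfolding q by (simp add: sin_diff cos_diff algebra_simps)
qed

text \<open>The bound of \<open>energy_ge\<close> equals
  \<open>pi\<^sup>2/4 - (cos q + q * sin q)\<^sup>2\<close>. Here \<open>p\<close> is arbitrary
  because at time 0 it is \<open>pi/2\<close> times the initial value.\<close>

lemma energy_nonneg:
  assumes "0 < q" "q \<le> pi/2"
  shows "0 \<le> energy p q"
proof -
  have "0 \<le> cos q" "0 \<le> sin q" using assms by (auto intro: cos_ge_zero sin_ge_zero)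
  then have "(cos q + q * sin q)\<^sup>2 \<le> (pi/2)\<^sup>2"
    using cos_plus_mult_sin_le[of q] assms by (intro power_mono) auto
  moreover have "(cos q + q * sin q)\<^sup>2 + (sin q - q * cos q)\<^sup>2 = ((sin q)\<^sup>2 + (cos q)\<^sup>2) * (1 + q\<^sup>2)"
    by algebra
  ultimately show ?thesis using energy_ge[of q p] assms by (simp add: power_divide)
qed

lemma energy_expand:
  "energy p q = pi\<^sup>2/4 + p\<^sup>2 + (p * cot q)\<^sup>2 - 2 * p * q - 2 * (p * cot q)"
proof -
  have "K - 1 - q\<^sup>2 + (q - p)\<^sup>2 + (1 - x)\<^sup>2 = K + p\<^sup>2 + x\<^sup>2 - 2 * p * q - 2 * x" for K x :: real
    by algebra
  then show ?thesis unfolding energy_def .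
qed

lemma cos_le_mult_cot:
  fixes q :: real
  assumes "0 < q" "q \<le> pi/2"
  shows "cos q \<le> q * cot q"
proof -
  have s: "0 < sin q" using assms by (intro sin_gt_zero) auto
  have "cos q * sin q \<le> cos q * q"
    using assms by (intro mult_left_mono sin_x_le_x cos_ge_zero) auto
  then show ?thesis using s by (simp add: cot_def field_simps)
qed

section \<open>Sequences of angles\<close>

text \<open>\<open>P n\<close> is the angle at time \<open>n\<close>;
  \<open>(P n * cot (P (Suc n)))\<^sup>2\<close> is \<open>pi\<^sup>2/4\<close> times
  \<open>\<sigma>\<^sub>n\<^sub>+\<^sub>1\<^sup>2\<close>.\<close>

locale angle_sequence =
  fixes P :: "nat \<Rightarrow> real" and \<delta> :: real
  assumes delta: "pi\<^sup>2/4 - 1 < \<delta>"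
    and pos: "0 < P n" and le: "P n \<le> pi/2"
    and step: "\<delta> * (P (Suc n) * cot (P (Suc (Suc n))))\<^sup>2 = energy (P n) (P (Suc n))"
begin

lemma delta_gt_1: "1 < \<delta>"
  using delta pi_squared_bounds by simp

lemma lower:
  assumes "1 \<le> n"
  shows "pi\<^sup>2/4 - 1 - (P n)\<^sup>2 + (sin (P n) - P n * cos (P n))\<^sup>2 \<le> \<delta> * (P n * cot (P (Suc n)))\<^sup>2"
  using assms step[of "n - 1"] energy_ge[OF pos le, of n] by simp

lemma tendsto_step:
  assumes "X \<longlonglongrightarrow> p" "Y \<longlonglongrightarrow> q" "Z \<longlonglongrightarrow> w" and "0 < q" "q \<le> pi/2" "0 < w" "w \<le> pi/2"
    and "\<And>n. \<delta> * (Y n * cot (Z n))\<^sup>2 = energy (X n) (Y n)"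
  shows "\<delta> * (q * cot w)\<^sup>2 = energy p q"
proof -
  have "sin q \<noteq> 0" "sin w \<noteq> 0" using assms sin_gt_zero[of q] sin_gt_zero[of w] by auto
  then have "(\<lambda>n. cot (Y n)) \<longlonglongrightarrow> cot q" "(\<lambda>n. cot (Z n)) \<longlonglongrightarrow> cot w"
    using assms by (auto intro!: isCont_tendsto_compose[OF isCont_cot])
  then have "(\<lambda>n. \<delta> * (Y n * cot (Z n))\<^sup>2) \<longlonglongrightarrow> \<delta> * (q * cot w)\<^sup>2"
    "(\<lambda>n. energy (X n) (Y n)) \<longlonglongrightarrow> energy p q"
    unfolding energy_def using assms(1,2) by - (intro tendsto_intros; assumption)+
  then show ?thesis unfolding assms(8) by (rule LIMSEQ_unique)
qed

text \<open>Claim (i). A decreasing sequence has a limit \<open>p\<close>: if positive, it is a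
  fixed point, against \<open>energy_less\<close>; if 0, the nonnegative \<open>s\<close> would drop
  forever. The index is at least 1 so that \<open>lower\<close> is available there.\<close>

lemma ex_increase: "\<exists>n\<ge>1. P n \<le> P (Suc n)"
proof (rule ccontr)
  assume "\<not> ?thesis"
  then have dec: "P (Suc (Suc n)) < P (Suc n)" for n by (auto simp: not_le)
  then have "decseq (\<lambda>n. P (Suc n))" by (intro decseq_SucI) (simp add: less_imp_le)
  then obtain p where lim: "(\<lambda>n. P (Suc n)) \<longlonglongrightarrow> p" and ge: "\<And>n. p \<le> P (Suc n)"
    using decseq_convergent[of "\<lambda>n. P (Suc n)" 0] pos by (metis less_imp_le)
  have lim': "P \<longlonglongrightarrow> p" using lim by (rule LIMSEQ_imp_Suc)
  have "0 \<le> p" using LIMSEQ_le_const[OF lim', of 0] pos by (auto intro: less_imp_le)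
  have p: "p < pi/2" using ge[of 1] dec[of 0] le[of 1] by simp
  show False
  proof (cases "p = 0")
    case False
    with \<open>0 \<le> p\<close> have "0 < p" by simp
    have "\<delta> * (p * cot p)\<^sup>2 = energy p p"
      using lim' LIMSEQ_Suc[OF lim'] LIMSEQ_Suc[OF LIMSEQ_Suc[OF lim']] \<open>0 < p\<close> p step
      by (intro tendsto_step[of P p "\<lambda>n. P (Suc n)" p "\<lambda>n. P (Suc (Suc n))" p]) auto
    also have "\<dots> < (pi\<^sup>2/4 - 1) * (p * cot p)\<^sup>2" using energy_less[of p p] \<open>0 < p\<close> p by simp
    also have "\<dots> \<le> \<delta> * (p * cot p)\<^sup>2" using delta by (intro mult_right_mono) auto
    finally show False by simp
  next
    case True
    define s where "s n = (P n * cot (P (Suc n)))\<^sup>2" for n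
    \<comment> \<open>For \<open>n \<ge> 1\<close>, \<open>x n\<close> bounds
      \<open>\<delta> * s (Suc n) - \<delta> * s n\<close>, with
      \<open>P n * cot (P (Suc n))\<close> replaced by its lower bound
      \<open>cos (P (Suc n))\<close>. Its limit is negative by the condition on
      \<open>\<delta>\<close>.\<close>
    define x where "x n = pi\<^sup>2/4 + (P n)\<^sup>2 - 2 * cos (P (Suc n)) - (\<delta> - 1) * (cos (P (Suc n)))\<^sup>2" for n
    have "x \<longlonglongrightarrow> pi\<^sup>2/4 + 0\<^sup>2 - 2 * cos 0 - (\<delta> - 1) * (cos 0)\<^sup>2"
      unfolding x_def using lim' lim True by (intro tendsto_intros) auto
    then have "x \<longlonglongrightarrow> pi\<^sup>2/4 - 1 - \<delta>" by (simp add: algebra_simps)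
    moreover define \<eta> where "\<eta> = (\<delta> + 1 - pi\<^sup>2/4) / 2"
    then have \<eta>: "0 < \<eta>" "pi\<^sup>2/4 - 1 - \<delta> < - \<eta>" using delta by auto
    ultimately have "\<forall>\<^sub>F n in sequentially. x n < - \<eta>" by (intro order_tendstoD)
    then obtain N where N: "\<And>n. N \<le> n \<Longrightarrow> x n < - \<eta>" by (auto simp: eventually_sequentially)
    have s_step: "s (Suc n) \<le> s n - \<eta> / \<delta>" if n: "N \<le> n" "1 \<le> n" for n
    proof -
      define y where "y = P n * cot (P (Suc n))"
      define c where "c = cos (P (Suc n))"
      have c: "0 \<le> c" unfolding c_def using pos[of "Suc n"] le[of "Suc n"] by (intro cos_ge_zero) auto
      have "c \<le> P (Suc n) * cot (P (Suc n))" unfolding c_def using cos_le_mult_cot[OF pos le] .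
      also have "\<dots> \<le> y" unfolding y_def using dec[of "n - 1"] n mult_cot_bounds[OF pos le]
        by (intro mult_right_mono) auto
      finally have "c \<le> y" .
      moreover from this have "c\<^sup>2 \<le> y\<^sup>2" using c by (intro power_mono)
      then have "(\<delta> - 1) * c\<^sup>2 \<le> (\<delta> - 1) * y\<^sup>2" using delta_gt_1 by (intro mult_left_mono) auto
      moreover have "0 \<le> P n * P (Suc n)" using pos by (simp add: less_imp_le)
      moreover have "\<delta> * s (Suc n) = pi\<^sup>2/4 + (P n)\<^sup>2 + y\<^sup>2 - 2 * (P n * P (Suc n)) - 2 * y"
        unfolding s_def step energy_expand y_def by simp
      moreover have "pi\<^sup>2/4 + (P n)\<^sup>2 - 2 * c - (\<delta> - 1) * c\<^sup>2 < - \<eta>" using N[OF n(1)] by (simp add: x_def c_def)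
      moreover have "(\<delta> - 1) * y\<^sup>2 = \<delta> * y\<^sup>2 - y\<^sup>2" by algebra
      ultimately have "\<delta> * s (Suc n) \<le> \<delta> * y\<^sup>2 - \<eta>" by linarith
      also have "\<dots> = \<delta> * (s n - \<eta> / \<delta>)" using delta_gt_1 by (simp add: s_def y_def field_simps)
      finally show ?thesis using delta_gt_1 by simp
    qed
    have "s (Suc N + k) \<le> s (Suc N) - real k * (\<eta> / \<delta>)" for k
    proof (induction k)
      case (Suc k)
      then show ?case using s_step[of "Suc N + k"] by (simp add: algebra_simps add_divide_distrib)
    qed simp
    moreover obtain k :: nat where "s (Suc N) < real k * (\<eta> / \<delta>)"
      using reals_Archimedean3[of "\<eta> / \<delta>"] \<eta> delta_gt_1 by auto
    ultimately have "s (Suc N + k) < 0" by (smt (verit))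
    then show False by (simp add: s_def)
  qed
qed

lemma increase_after_step_weak:
  assumes "P n \<le> P (Suc n)"
  shows "P n \<le> P (Suc (Suc n))"
proof (cases "P n < pi/2")
  case True
  then show ?thesis
    using increase_after_step[OF pos assms le True pos le delta step] by simp
next
  case False
  then have 1: "P n = pi/2" "P (Suc n) = pi/2" using le[of n] le[of "Suc n"] assms by auto
  have "energy (pi/2) (pi/2) = 0" by (simp add: energy_def cot_def power_divide)
  then have "cot (P (Suc (Suc n))) = 0" using step[of n] delta_gt_1 unfolding 1 by simp
  moreover have "cot (pi/2) = (0 :: real)" by (simp add: cot_def)
  ultimately have "\<not> cot (pi/2) < cot (P (Suc (Suc n)))" by simp
  then show ?thesis using cot_less_iff[OF pos le, of "pi/2" "Suc (Suc n)"] 1 by simp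
qed

text \<open>If \<open>a \<le> b\<close>, then \<open>a = M\<close> and strict (ii) gives
  \<open>c > M\<close>; hence \<open>b = M\<close>, and likewise \<open>d > M\<close>, against
  \<open>min c d = M\<close>. If \<open>b < a\<close>, the same argument starts at \<open>b\<close>,
  hence five angles.\<close>

lemma stationary_contradiction:
  assumes mins: "min a b = M" "min b c = M" "min c d = M" "min d e = M"
    and M: "0 < M" "M < pi/2"
    and bnd: "a \<le> pi/2" "b \<le> pi/2" "c \<le> pi/2" "d \<le> pi/2" "e \<le> pi/2"
    and steps: "\<delta> * (b * cot c)\<^sup>2 = energy a b" "\<delta> * (c * cot d)\<^sup>2 = energy b c"
      "\<delta> * (d * cot e)\<^sup>2 = energy c d"
  shows False
proof -
  have inc: "p < w" if "p \<le> q" "p = M" "M \<le> w" "q \<le> pi/2" "w \<le> pi/2" "\<delta> * (q * cot w)\<^sup>2 = energy p q" for p q w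
    using that M increase_after_step[OF _ that(1) _ _ _ _ delta that(6)] by simp
  have *: "False" if "a \<le> b" "min a b = M" "min b c = M" "min c d = M"
      "b \<le> pi/2" "c \<le> pi/2" "d \<le> pi/2"
      "\<delta> * (b * cot c)\<^sup>2 = energy a b" "\<delta> * (c * cot d)\<^sup>2 = energy b c" for a b c d
  proof -
    have "a < c" using that by (intro inc[of a b c]) auto
    then have "b = M" "b \<le> c" using that by (auto simp: min_def split: if_splits)
    then have "b < d" using that by (intro inc[of b c d]) auto
    then show False using that \<open>a < c\<close> \<open>b = M\<close> by (auto simp: min_def split: if_splits)
  qed
  show False
  proof (cases "a \<le> b")
    case True
    then show False using * mins bnd steps by blast
  next
    case False
    then have "b \<le> c" using mins by (auto simp: min_def split: if_splits)
    then show False using * mins bnd steps by blast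
  qed
qed

theorem tendsto_pi_half: "P \<longlonglongrightarrow> pi/2"
proof -
  obtain N where N: "1 \<le> N" "P N \<le> P (Suc N)" using ex_increase by blast
  \<comment> \<open>If both alternatives fail at \<open>Suc n\<close>, the induction hypothesis
    supplies the preceding increase that \<open>no_two_decreases\<close> requires.\<close>
  have alt: "P n \<le> P (Suc n) \<or> P (Suc n) \<le> P (Suc (Suc n))" if "N \<le> n" for n
    using that
  proof (induction n rule: dec_induct)
    case (step n)
    show ?case
    proof (rule ccontr)
      assume "\<not> ?case"
      then have "P n \<le> P (Suc n)" "P (Suc (Suc n)) < P (Suc n)" "P (Suc (Suc (Suc n))) < P (Suc (Suc n))"
        using step.IH by auto
      then show False
        using no_two_decreases[of "P n" "P (Suc n)" "P (Suc (Suc n))" "P (Suc (Suc (Suc n)))" \<delta>]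
          pos le delta lower[of n] angle_sequence.step[OF angle_sequence_axioms] step.hyps N by force
    qed
  qed (use N in auto)
  define m where "m n = min (P (n + N)) (P (Suc (n + N)))" for n
  have mono: "m n \<le> m (Suc n)" for n
  proof (cases "P (n + N) \<le> P (Suc (n + N))")
    case True
    then show ?thesis using increase_after_step_weak[OF True] by (auto simp: m_def)
  next
    case False
    then show ?thesis using alt[of "n + N"] by (auto simp: m_def)
  qed
  then have "incseq m" by (rule incseq_SucI)
  moreover have m_le: "m n \<le> pi/2" for n unfolding m_def using le by (rule min.coboundedI1)
  ultimately obtain M where M: "m \<longlonglongrightarrow> M" "\<And>n. m n \<le> M" by (metis incseq_convergent)
  have m0: "0 < m 0" using pos by (simp add: m_def)
  have "M \<le> pi/2" using LIMSEQ_le_const2[OF M(1)] m_le by blast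
  moreover have "\<not> M < pi/2"
  proof
    assume "M < pi/2"
    \<comment> \<open>The lower end \<open>m 0 > 0\<close> keeps the limit angles positive, where
      \<open>cot\<close> is continuous.\<close>
    define S where "S = {m 0..pi/2}"
    define f where "f n = (P (n + N), P (Suc (n + N)), P (Suc (Suc (n + N))),
      P (Suc (Suc (Suc (n + N)))), P (Suc (Suc (Suc (Suc (n + N))))))" for n
    have PS: "P (n + N) \<in> S" for n
      using incseqD[OF \<open>incseq m\<close>, of 0 n] le by (auto simp: S_def m_def)
    have "f n \<in> S \<times> S \<times> S \<times> S \<times> S" for n
      using PS[of n] PS[of "Suc n"] PS[of "Suc (Suc n)"] PS[of "Suc (Suc (Suc n))"]
        PS[of "Suc (Suc (Suc (Suc n)))"] by (simp add: f_def)
    moreover have "seq_compact (S \<times> S \<times> S \<times> S \<times> S)"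
      by (intro compact_imp_seq_compact compact_Times) (simp_all add: S_def)
    ultimately obtain l r where l: "l \<in> S \<times> S \<times> S \<times> S \<times> S" and r: "strict_mono r" and lim: "(f \<circ> r) \<longlonglongrightarrow> l"
      by (metis seq_compactE)
    obtain a b c d e where abc: "l = (a, b, c, d, e)" by (cases l) auto
    have in_S: "a \<in> S" "b \<in> S" "c \<in> S" "d \<in> S" "e \<in> S" using l abc by auto
    have lims: "(\<lambda>n. P (r n + N)) \<longlonglongrightarrow> a" "(\<lambda>n. P (Suc (r n + N))) \<longlonglongrightarrow> b"
      "(\<lambda>n. P (Suc (Suc (r n + N)))) \<longlonglongrightarrow> c" "(\<lambda>n. P (Suc (Suc (Suc (r n + N))))) \<longlonglongrightarrow> d"
      "(\<lambda>n. P (Suc (Suc (Suc (Suc (r n + N)))))) \<longlonglongrightarrow> e"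
      using lim tendsto_fst[OF lim] tendsto_fst[OF tendsto_snd[OF lim]]
        tendsto_fst[OF tendsto_snd[OF tendsto_snd[OF lim]]]
        tendsto_fst[OF tendsto_snd[OF tendsto_snd[OF tendsto_snd[OF lim]]]]
        tendsto_snd[OF tendsto_snd[OF tendsto_snd[OF tendsto_snd[OF lim]]]]
      by (simp_all add: f_def abc o_def)
    have m_sub: "(\<lambda>n. m (r n + k)) \<longlonglongrightarrow> M" for k
      using LIMSEQ_subseq_LIMSEQ[OF LIMSEQ_ignore_initial_segment[OF M(1), of k] r] by (simp add: o_def)
    have min: "min x y = M" if "(\<lambda>n. m (r n + k)) = (\<lambda>n. min (X n) (Y n))" "X \<longlonglongrightarrow> x" "Y \<longlonglongrightarrow> y" for k x y X Y
      using LIMSEQ_unique[OF _ m_sub[of k]] tendsto_min[OF that(2,3)] that(1) by simp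
    show False
    proof (rule stationary_contradiction[of a b M c d e])
      show "min a b = M" by (rule min[of 0, OF _ lims(1,2)]) (simp add: m_def)
      show "min b c = M" by (rule min[of 1, OF _ lims(2,3)]) (simp add: m_def)
      show "min c d = M" by (rule min[of 2, OF _ lims(3,4)]) (simp add: m_def)
      show "min d e = M" by (rule min[of 3, OF _ lims(4,5)]) (simp add: m_def numeral_3_eq_3)
      show "0 < M" using m0 M(2)[of 0] by simp
      show "\<delta> * (b * cot c)\<^sup>2 = energy a b"
        by (rule tendsto_step[OF lims(1,2,3)]) (use in_S m0 step in \<open>auto simp: S_def\<close>)
      show "\<delta> * (c * cot d)\<^sup>2 = energy b c"
        by (rule tendsto_step[OF lims(2,3,4)]) (use in_S m0 step in \<open>auto simp: S_def\<close>)
      show "\<delta> * (d * cot e)\<^sup>2 = energy c d"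
        by (rule tendsto_step[OF lims(3,4,5)]) (use in_S m0 step in \<open>auto simp: S_def\<close>)
    qed (use in_S \<open>M < pi/2\<close> in \<open>auto simp: S_def\<close>)
  qed
  ultimately have "M = pi/2" by linarith
  with M have "m \<longlonglongrightarrow> pi/2" by (simp only:)
  then have "(\<lambda>n. P (n + N)) \<longlonglongrightarrow> pi/2"
    by (rule tendsto_sandwich[OF _ _ _ tendsto_const, rotated 2]) (simp_all add: m_def le always_eventually del: less_divide_eq_numeral1 le_divide_eq_numeral1)
  then show ?thesis by (rule LIMSEQ_offset)
qed

end

text \<open>For \<open>s = 0\<close> the last equation reads \<open>0 = a cot (\<pi>/2)\<close>.\<close>

lemma atq_bounds:
  assumes "0 < a" "0 \<le> s"
  shows "0 < atq a s" "atq a s \<le> pi/2" "s = a * cot (atq a s)"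
proof -
  show "0 < atq a s" "atq a s \<le> pi/2"
    using assms arctan_bounded[of "a / s"] by (auto simp: atq_def less_imp_le)
  show "s = a * cot (atq a s)"
  proof (cases "s = 0")
    case False
    then show ?thesis using assms tan_arctan[of "a / s"] 
      by (simp add: atq_def cot_altdef tan_arctan)
  qed (use assms in \<open>simp add: atq_def cot_def\<close>)
qed

section \<open>From angles back to state evolution\<close>

lemma psi2_eq_energy:
  assumes "0 < a" "0 \<le> s2"
  shows "psi2 a s2 \<delta> 0 = 4 / pi\<^sup>2 / \<delta> * energy (pi/2 * a) (atq a (sqrt s2))"
proof -
  define q where "q = atq a (sqrt s2)"
  define s where "s = sqrt s2"
  have q: "s = a * cot q" using atq_bounds(3)[of a s] assms by (simp add: q_def s_def)
  have "s2 = s\<^sup>2" using assms by (simp add: s_def)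
  then have "psi2 a s2 \<delta> 0 = (a\<^sup>2 + s\<^sup>2 + 1 - 4 * s / pi - 4 * a / pi * q) / \<delta>"
    by (simp add: psi2_def q_def s_def)
  also have "a\<^sup>2 + s\<^sup>2 + 1 - 4 * s / pi - 4 * a / pi * q = 4 / pi\<^sup>2 * energy (pi/2 * a) q"
    unfolding energy_expand q by (simp add: field_simps power2_eq_square)
  finally show ?thesis by (simp add: q_def)
qed

text \<open>Since \<open>atq\<close> is odd in its first argument, \<open>psi1\<close> is odd and
  \<open>psi2\<close> is even there.\<close>

lemma SE_uminus:
  "SE (- a) s \<delta> w t = (- fst (SE a s \<delta> w t), snd (SE a s \<delta> w t))"
proof (induction t)
  case (Suc t)
  have "atq (- x) y = - atq x y" for x y by (simp add: atq_def arctan_minus sgn_minus)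
  then show ?case by (simp add: Suc case_prod_beta psi1_def psi2_def Let_def)
qed simp

text \<open>The angles \<open>P t\<close> form an \<open>angle_sequence\<close> and tend to
  \<open>pi/2\<close>, so \<open>A (Suc t) = 2 / pi * P t\<close> tends to 1 and
  \<open>sqrt (S t) = A t * cot (P t)\<close> to 0.\<close>

lemma SE_tendsto:
  assumes d: "\<delta> > pi\<^sup>2/4 - 1" and "0 < a0" "0 \<le> s0"
  shows "(\<lambda>t. fst (SE a0 s0 \<delta> 0 t)) \<longlonglongrightarrow> 1 \<and> (\<lambda>t. snd (SE a0 s0 \<delta> 0 t)) \<longlonglongrightarrow> 0"
proof -
  define A where "A t = fst (SE a0 s0 \<delta> 0 t)" for t
  define S where "S t = snd (SE a0 s0 \<delta> 0 t)" for t
  define P where "P t = atq (A t) (sqrt (S t))" for t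
  have dpos: "0 < \<delta>" using d pi_squared_bounds by simp
  have A_Suc: "A (Suc t) = 2 / pi * P t" for t
    by (simp add: A_def S_def P_def psi1_def case_prod_beta)
  have S_Suc: "S (Suc t) = psi2 (A t) (S t) \<delta> 0" for t
    by (simp add: A_def S_def case_prod_beta)
  have inv: "0 < A t \<and> 0 \<le> S t" for t
  proof (induction t)
    case 0
    then show ?case using assms by (simp add: A_def S_def)
  next
    case (Suc t)
    then have "0 < P t" "P t \<le> pi/2" unfolding P_def using atq_bounds(1,2)[of "A t" "sqrt (S t)"] by auto
    then show ?case
      using Suc dpos energy_nonneg[of "P t"] by (simp add: A_Suc S_Suc psi2_eq_energy P_def[symmetric])
  qed
  have P: "0 < P t" "P t \<le> pi/2" "sqrt (S t) = A t * cot (P t)" for t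
    unfolding P_def using atq_bounds[of "A t" "sqrt (S t)"] inv by auto
  have S: "S t = (A t * cot (P t))\<^sup>2" for t using P(3)[of t] inv by (metis real_sqrt_pow2)
  interpret angle_sequence P \<delta>
  proof
    fix n
    have "S (Suc (Suc n)) = 4 / pi\<^sup>2 / \<delta> * energy (pi/2 * A (Suc n)) (P (Suc n))"
      unfolding S_Suc[of "Suc n"] P_def[of "Suc n"] using inv by (intro psi2_eq_energy) auto
    also have "pi/2 * A (Suc n) = P n" by (simp add: A_Suc)
    finally have "\<delta> * S (Suc (Suc n)) = 4 / pi\<^sup>2 * energy (P n) (P (Suc n))" using dpos by simp
    then have "4 / pi\<^sup>2 * (\<delta> * (P (Suc n) * cot (P (Suc (Suc n))))\<^sup>2) = 4 / pi\<^sup>2 * energy (P n) (P (Suc n))"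
      unfolding S[of "Suc (Suc n)"] A_Suc[of "Suc n"] by (simp add: power2_eq_square mult_ac)
    then show "\<delta> * (P (Suc n) * cot (P (Suc (Suc n))))\<^sup>2 = energy (P n) (P (Suc n))" by simp
  qed (use d P in auto)
  have "(\<lambda>t. A (Suc t)) \<longlonglongrightarrow> 2 / pi * (pi/2)"
    unfolding A_Suc by (intro tendsto_intros tendsto_pi_half)
  then have A: "A \<longlonglongrightarrow> 1" using LIMSEQ_imp_Suc[of A 1] by simp
  have "(\<lambda>t. cot (P t)) \<longlonglongrightarrow> cot (pi/2)"
    by (rule isCont_tendsto_compose[OF isCont_cot tendsto_pi_half]) simp
  with A have "S \<longlonglongrightarrow> (1 * cot (pi/2))\<^sup>2" unfolding S by (intro tendsto_intros)
  with A show ?thesis by (simp add: A_def[abs_def] S_def[abs_def] cot_def)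
qed

theorem mainTheorem4:
  fixes \<delta> \<alpha>0 \<sigma>0sq :: real
  assumes "\<delta> > pi^2 / 4 - 1"
    and "\<alpha>0 \<noteq> 0"
    and "\<sigma>0sq \<ge> 0"
  shows "(\<lambda>t. \<bar>fst (SE \<alpha>0 \<sigma>0sq \<delta> 0 t)\<bar>) \<longlonglongrightarrow> 1
     \<and> (\<lambda>t. snd (SE \<alpha>0 \<sigma>0sq \<delta> 0 t)) \<longlonglongrightarrow> 0"
proof -
  have "fst (SE \<alpha>0 \<sigma>0sq \<delta> 0 t) = fst (SE \<bar>\<alpha>0\<bar> \<sigma>0sq \<delta> 0 t) \<or> fst (SE \<alpha>0 \<sigma>0sq \<delta> 0 t) = - fst (SE \<bar>\<alpha>0\<bar> \<sigma>0sq \<delta> 0 t)"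
    "snd (SE \<alpha>0 \<sigma>0sq \<delta> 0 t) = snd (SE \<bar>\<alpha>0\<bar> \<sigma>0sq \<delta> 0 t)" for t
    using SE_uminus[of "\<alpha>0" \<sigma>0sq \<delta> 0 t] by (auto simp: abs_if)
  then have eq: "\<bar>fst (SE \<alpha>0 \<sigma>0sq \<delta> 0 t)\<bar> = \<bar>fst (SE \<bar>\<alpha>0\<bar> \<sigma>0sq \<delta> 0 t)\<bar>"
    "snd (SE \<alpha>0 \<sigma>0sq \<delta> 0 t) = snd (SE \<bar>\<alpha>0\<bar> \<sigma>0sq \<delta> 0 t)" for t
    by (metis abs_minus_cancel)+
  have "(\<lambda>t. fst (SE \<bar>\<alpha>0\<bar> \<sigma>0sq \<delta> 0 t)) \<longlonglongrightarrow> 1" "(\<lambda>t. snd (SE \<bar>\<alpha>0\<bar> \<sigma>0sq \<delta> 0 t)) \<longlonglongrightarrow> 0"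
    using SE_tendsto[OF assms(1), of "\<bar>\<alpha>0\<bar>" \<sigma>0sq] assms(2,3) by auto
  then show ?thesis unfolding eq using tendsto_rabs by fastforce
qed

end
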